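(* For every fixed choice of the bad-partition parameter $p\in(0,1)$, pdqsort (as described in the context) has worst-case running time $O(n\log n)$ on arrays of length $n$.
   Context: Setting. The input is an array $A[0..n-1]$ ($n\ge 1$) of elements compared by a strict weak ordering $<$. Two elements $a,b$ compare equal if neither $a<b$ nor $b<a$; $a\le b$ means "not $b<a$". Running time counts elementary operations, each comparison or element move costing $O(1)$. Pattern-defeating quicksort (pdqsort) has fixed constants: an insertion-sort threshold $c\ge 3$, a bad-partition parameter $p\in(0,1)$ (the reference implementation uses $p=1/8$), and a constant bound on element moves for a partial insertion sort. It is the following recursive procedure acting in place on contiguous subarrays $A[a..b)=(A[a],\dots,A[b-1])$, each call carrying an integer counter $t$; the top-level call is on $A[0..n)$ with $t=\lfloor\log_2 n\rfloor$. A subarray $A[a..b)$ is leftmost if $a=0$; otherwise its predecessor is the element currently at position $a-1$. A call on $A[a..b)$ with $m=b-a$ and counter $t$ does: (1) if $m\le c$, sort $A[a..b)$ by insertion sort and return; (2) if $t=0$, sort $A[a..b)$ by heapsort and return; (3) select a pivot $q$ from $A[a..b)$ as the median of at least three sampled elements of $A[a..b)$ by a deterministic rule using $O(1)$ comparisons, and move it to position $a$; (4) if $a>0$ and the predecessor compares equal to $q$, apply partition_left: in $O(m)$ time rearrange $A[a..b)$ so that $q$ ends at a position $r$, every element of $A[a..r)$ is $\le q$ and every element of $A[r+1..b)$ is $>q$. Otherwise apply partition_right: in $O(m)$ time rearrange so that $q$ ends at a position $r$, every element of $A[a..r)$ is $<q$ and every element of $A[r+1..b)$ is $\ge q$; (5)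 the partition is bad if $\min(r-a,\,b-r-1)<p\,m$, and good otherwise; if it is bad, set $t:=t-1$ and swap $O(1)$ elements at fixed relative positions inside each of the two parts; (6) if partition_right was applied, the partition is good, and the partition step moved no element other than the pivot, run on each of $A[a..r)$ and $A[r+1..b)$ an insertion sort that aborts after the constant number of element moves; if both complete, return; (7) if partition_left was applied, recurse only on $A[r+1..b)$ with counter $t$; otherwise recurse on $A[a..r)$ and then on $A[r+1..b)$, each with counter $t$. The counter is local to each call (decrements in one subtree do not affect other subtrees). *)

theory Defs
  imports
    Complex_Main
    "HOL-Combinatorics.Permutations"
    "HOL-Library.Extended_Nat"
    "HOL-Library.Landau_Symbols"
begin

definition compares_equal :: "('a \<Rightarrow> 'a \<Rightarrow> bool) \<Rightarrow> 'a \<Rightarrow> 'a \<Rightarrow> bool" where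
  "compares_equal lt x y \<longleftrightarrow> \<not> lt x y \<and> \<not> lt y x"

definition strict_weak_ordering :: "('a \<Rightarrow> 'a \<Rightarrow> bool) \<Rightarrow> bool" where
  "strict_weak_ordering lt \<longleftrightarrow> irreflp lt \<and> transp lt \<and> transp (compares_equal lt)"

text \<open>
  Arrays are lists, and a subarray \<open>A[a..b)\<close> is given by the whole array and its two bounds.
  Every procedure returns, as its last component, the number of elementary operations it executed:
  a comparison counts 1, a swap of two elements counts 3 (three element moves), and calls and
  loop iterations count 1 each.
\<close>

definition swap :: "nat \<Rightarrow> nat \<Rightarrow> 'a list \<Rightarrow> 'a list" where
  "swap i j A = A[i := A ! j, j := A ! i]"

text \<open>
  \<open>insert_at lt a d l A\<close> inserts the element at position \<open>a + d\<close> into the sorted run \<open>A[a..a+d)\<close>.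
  The number \<open>l\<close> is the remaining budget of element moves, where moving the inserted element
  past one other element uses one unit; the Boolean in the result is False iff the
  insertion was aborted because the budget was used up.
\<close>
fun insert_at :: "('a \<Rightarrow> 'a \<Rightarrow> bool) \<Rightarrow> nat \<Rightarrow> nat \<Rightarrow> enat \<Rightarrow> 'a list \<Rightarrow> bool \<times> enat \<times> 'a list \<times> nat" where
  "insert_at lt a 0 l A = (True, l, A, 0)"
| "insert_at lt a (Suc d) l A =
     (if \<not> lt (A ! (a + Suc d)) (A ! (a + d)) then (True, l, A, 1)
      else if l = 0 then (False, l, A, 1)
      else let (ok, l', B, k) = insert_at lt a d (l - 1) (swap (a + d) (a + Suc d) A)
           in (ok, l', B, k + 4))"

fun insertion_loop :: "('a \<Rightarrow> 'a \<Rightarrow> bool) \<Rightarrow> nat \<Rightarrow> nat list \<Rightarrow> enat \<Rightarrow> 'a list \<Rightarrow> bool \<times> 'a list \<times> nat" where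
  "insertion_loop lt a [] l A = (True, A, 0)"
| "insertion_loop lt a (d # ds) l A =
     (let (ok, l', B, k) = insert_at lt a d l A
      in if ok then let (ok', C, k') = insertion_loop lt a ds l' B in (ok', C, k + 1 + k')
         else (False, B, k + 1))"

definition partial_insertion_sort ::
    "('a \<Rightarrow> 'a \<Rightarrow> bool) \<Rightarrow> enat \<Rightarrow> nat \<Rightarrow> nat \<Rightarrow> 'a list \<Rightarrow> bool \<times> 'a list \<times> nat" where
  "partial_insertion_sort lt l a b A = insertion_loop lt a [1..<b - a] l A"

definition insertion_sort :: "('a \<Rightarrow> 'a \<Rightarrow> bool) \<Rightarrow> nat \<Rightarrow> nat \<Rightarrow> 'a list \<Rightarrow> 'a list \<times> nat" where
  "insertion_sort lt a b A = snd (partial_insertion_sort lt \<infinity> a b A)"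

text \<open>
  The heap occupies \<open>A[a..a+m)\<close>; the node with index \<open>i\<close> is at position \<open>a + i\<close> and has the
  children \<open>2 * i + 1\<close> and \<open>2 * i + 2\<close>.
\<close>
function sift_down :: "('a \<Rightarrow> 'a \<Rightarrow> bool) \<Rightarrow> nat \<Rightarrow> nat \<Rightarrow> nat \<Rightarrow> 'a list \<Rightarrow> 'a list \<times> nat" where
  "sift_down lt a m i A =
     (if m \<le> 2 * i + 1 then (A, 1)
      else let j = (if 2 * i + 2 < m \<and> lt (A ! (a + (2 * i + 1))) (A ! (a + (2 * i + 2)))
                    then 2 * i + 2 else 2 * i + 1)
           in if lt (A ! (a + i)) (A ! (a + j))
              then let (B, k) = sift_down lt a m j (swap (a + i) (a + j) A) in (B, k + 6)
              else (A, 3))"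
  by pat_completeness auto
termination
  by (relation "measure (\<lambda>(lt, a, m, i, A). m - i)") (auto split: if_splits)

fun build_heap :: "('a \<Rightarrow> 'a \<Rightarrow> bool) \<Rightarrow> nat \<Rightarrow> nat \<Rightarrow> nat \<Rightarrow> 'a list \<Rightarrow> 'a list \<times> nat" where
  "build_heap lt a m 0 A = (A, 0)"
| "build_heap lt a m (Suc i) A =
     (let (B, k) = sift_down lt a m i A; (C, k') = build_heap lt a m i B in (C, k + 1 + k'))"

fun extract_all :: "('a \<Rightarrow> 'a \<Rightarrow> bool) \<Rightarrow> nat \<Rightarrow> nat \<Rightarrow> 'a list \<Rightarrow> 'a list \<times> nat" where
  "extract_all lt a 0 A = (A, 0)"
| "extract_all lt a (Suc e) A =
     (let (B, k) = sift_down lt a e 0 (swap a (a + e) A); (C, k') = extract_all lt a e B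
      in (C, k + 4 + k'))"

definition heapsort :: "('a \<Rightarrow> 'a \<Rightarrow> bool) \<Rightarrow> nat \<Rightarrow> nat \<Rightarrow> 'a list \<Rightarrow> 'a list \<times> nat" where
  "heapsort lt a b A =
     (let (B, k) = build_heap lt a (b - a) ((b - a) div 2) A; (C, k') = extract_all lt a (b - a) B
      in (C, k + k'))"

text \<open>
  Rearrangements are permutations of positions: \<open>permute_list f A\<close> has at position \<open>i\<close> the
  element that was at position \<open>f i\<close> of \<open>A\<close>. A partition procedure returns the
  rearrangement, the final position of the pivot, and its cost. The swaps made after a bad partition
  are pairs of positions relative to the start of a part, given as a function of the length
  of that part.
\<close>
record 'a pdq_impl =
  threshold :: nat
  move_limit :: nat
  select_pivot :: "('a \<Rightarrow> 'a \<Rightarrow> bool) \<Rightarrow> nat \<Rightarrow> nat \<Rightarrow> 'a list \<Rightarrow> (nat \<Rightarrow> nat) \<times> nat"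
  partition_left :: "('a \<Rightarrow> 'a \<Rightarrow> bool) \<Rightarrow> nat \<Rightarrow> nat \<Rightarrow> 'a list \<Rightarrow> (nat \<Rightarrow> nat) \<times> nat \<times> nat"
  partition_right :: "('a \<Rightarrow> 'a \<Rightarrow> bool) \<Rightarrow> nat \<Rightarrow> nat \<Rightarrow> 'a list \<Rightarrow> (nat \<Rightarrow> nat) \<times> nat \<times> nat"
  left_swaps :: "nat \<Rightarrow> (nat \<times> nat) list"
  right_swaps :: "nat \<Rightarrow> (nat \<times> nat) list"

text \<open>For an even number of samples both the lower and the upper median are admitted.\<close>
definition is_median_at :: "('a \<Rightarrow> 'a \<Rightarrow> bool) \<Rightarrow> 'a list \<Rightarrow> nat set \<Rightarrow> nat \<Rightarrow> bool" where
  "is_median_at lt A S i \<longleftrightarrow> i \<in> S \<and>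
     2 * card {j \<in> S. lt (A ! j) (A ! i)} \<le> card S \<and>
     2 * card {j \<in> S. lt (A ! i) (A ! j)} \<le> card S"

definition pivot_rule ::
    "nat \<Rightarrow> (('a \<Rightarrow> 'a \<Rightarrow> bool) \<Rightarrow> nat \<Rightarrow> nat \<Rightarrow> 'a list \<Rightarrow> (nat \<Rightarrow> nat) \<times> nat) \<Rightarrow> bool" where
  "pivot_rule c sel \<longleftrightarrow>
     (\<exists>K. \<forall>lt a b A f k. strict_weak_ordering lt \<longrightarrow> c < b - a \<longrightarrow> b \<le> length A \<longrightarrow>
        sel lt a b A = (f, k) \<longrightarrow>
          f permutes {a..<b} \<and>
          (\<exists>S \<subseteq> {a..<b}. 3 \<le> card S \<and> is_median_at lt A S (f a)) \<and>
          k \<le> K)"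

text \<open>\<open>Pl lt q x\<close> and \<open>Pr lt q x\<close> describe the elements \<open>x\<close> left and right of the pivot \<open>q\<close>.\<close>
definition partition_rule ::
    "(('a \<Rightarrow> 'a \<Rightarrow> bool) \<Rightarrow> 'a \<Rightarrow> 'a \<Rightarrow> bool) \<Rightarrow> (('a \<Rightarrow> 'a \<Rightarrow> bool) \<Rightarrow> 'a \<Rightarrow> 'a \<Rightarrow> bool) \<Rightarrow>
     nat \<Rightarrow> (('a \<Rightarrow> 'a \<Rightarrow> bool) \<Rightarrow> nat \<Rightarrow> nat \<Rightarrow> 'a list \<Rightarrow> (nat \<Rightarrow> nat) \<times> nat \<times> nat) \<Rightarrow> bool" where
  "partition_rule Pl Pr c part \<longleftrightarrow>
     (\<exists>K. \<forall>lt a b A f r k. strict_weak_ordering lt \<longrightarrow> c < b - a \<longrightarrow> b \<le> length A \<longrightarrow>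
        part lt a b A = (f, r, k) \<longrightarrow>
          f permutes {a..<b} \<and> r \<in> {a..<b} \<and> f r = a \<and>
          (\<forall>i \<in> {a..<r}. Pl lt (A ! a) (permute_list f A ! i)) \<and>
          (\<forall>i \<in> {r + 1..<b}. Pr lt (A ! a) (permute_list f A ! i)) \<and>
          k \<le> K * (b - a))"

definition swap_rule :: "(nat \<Rightarrow> (nat \<times> nat) list) \<Rightarrow> bool" where
  "swap_rule sw \<longleftrightarrow>
     (\<exists>K. \<forall>m. length (sw m) \<le> K \<and> (\<forall>(i, j) \<in> set (sw m). i < m \<and> j < m))"

definition valid_pdq_impl :: "'a pdq_impl \<Rightarrow> bool" where
  "valid_pdq_impl P \<longleftrightarrow>
     3 \<le> threshold P \<and>
     pivot_rule (threshold P) (select_pivot P) \<and>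
     partition_rule (\<lambda>lt q x. \<not> lt q x) (\<lambda>lt q x. lt q x) (threshold P) (partition_left P) \<and>
     partition_rule (\<lambda>lt q x. lt x q) (\<lambda>lt q x. \<not> lt x q) (threshold P) (partition_right P) \<and>
     swap_rule (left_swaps P) \<and> swap_rule (right_swaps P)"

definition apply_swaps :: "nat \<Rightarrow> (nat \<times> nat) list \<Rightarrow> 'a list \<Rightarrow> 'a list" where
  "apply_swaps a sw A = fold (\<lambda>(i, j). swap (a + i) (a + j)) sw A"

text \<open>
  Everything between pivot selection and the recursive calls. The result consists of the array,
  the position of the pivot, the new counter, whether \<open>partition_left\<close> was applied, whether both
  partial insertion sorts completed, and the cost.

  Placing the pivot at position \<open>r\<close> necessarily moves an element to the vacated position \<open>a\<close>.
  Hence that no element other than the pivot was moved means that the partition step is at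
  most the exchange of the positions \<open>a\<close> and \<open>r\<close>.
\<close>
definition pdq_step ::
    "'a pdq_impl \<Rightarrow> real \<Rightarrow> ('a \<Rightarrow> 'a \<Rightarrow> bool) \<Rightarrow> nat \<Rightarrow> nat \<Rightarrow> nat \<Rightarrow> 'a list \<Rightarrow>
     'a list \<times> nat \<times> nat \<times> bool \<times> bool \<times> nat" where
  "pdq_step P p lt a b t A =
     (let (f, k1) = select_pivot P lt a b A;
          A1 = permute_list f A;
          left = (a > 0 \<and> compares_equal lt (A1 ! (a - 1)) (A1 ! a));
          k2 = (if a > 0 then 2 else 0);
          (g, r, k3) = (if left then partition_left P lt a b A1 else partition_right P lt a b A1);
          A2 = permute_list g A1;
          bad = (real (min (r - a) (b - r - 1)) < p * real (b - a))
      in if bad then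
           let sl = left_swaps P (r - a);
               sr = right_swaps P (b - r - 1);
               A3 = apply_swaps (r + 1) sr (apply_swaps a sl A2)
           in (A3, r, t - 1, left, False, k1 + k2 + k3 + 3 * length sl + 3 * length sr)
         else if \<not> left \<and> (\<forall>i \<in> {a..<b} - {a, r}. g i = i) then
           let (ok1, A3, k4) = partial_insertion_sort lt (enat (move_limit P)) a r A2;
               (ok2, A4, k5) = partial_insertion_sort lt (enat (move_limit P)) (r + 1) b A3
           in (A4, r, t, left, ok1 \<and> ok2, k1 + k2 + k3 + k4 + k5)
         else (A2, r, t, left, False, k1 + k2 + k3))"

text \<open>The result None stands for non-termination.\<close>
partial_function (option) pdq ::
    "'a pdq_impl \<Rightarrow> real \<Rightarrow> ('a \<Rightarrow> 'a \<Rightarrow> bool) \<Rightarrow> nat \<Rightarrow> nat \<Rightarrow> nat \<Rightarrow> 'a list \<Rightarrow> ('a list \<times> nat) option" where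
  "pdq P p lt a b t A =
     (if b - a \<le> threshold P then
        let (B, k) = insertion_sort lt a b A in Some (B, k + 1)
      else if t = 0 then
        let (B, k) = heapsort lt a b A in Some (B, k + 1)
      else
        let (B, r, t', left, finished, k) = pdq_step P p lt a b t A
        in if finished then Some (B, k + 1)
           else if left then
             Option.bind (pdq P p lt (r + 1) b t' B) (\<lambda>(C, k'). Some (C, k + 1 + k'))
           else
             Option.bind (pdq P p lt a r t' B) (\<lambda>(C, k').
               Option.bind (pdq P p lt (r + 1) b t' C) (\<lambda>(D, k'').
                 Some (D, k + 1 + k' + k''))))"

definition pdqsort :: "'a pdq_impl \<Rightarrow> real \<Rightarrow> ('a \<Rightarrow> 'a \<Rightarrow> bool) \<Rightarrow> 'a list \<Rightarrow> ('a list \<times> nat) option" where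
  "pdqsort P p lt A = pdq P p lt 0 (length A) (nat \<lfloor>log 2 (real (length A))\<rfloor>) A"

definition running_time :: "'a pdq_impl \<Rightarrow> real \<Rightarrow> ('a \<Rightarrow> 'a \<Rightarrow> bool) \<Rightarrow> 'a list \<Rightarrow> enat" where
  "running_time P p lt A = (case pdqsort P p lt A of None \<Rightarrow> \<infinity> | Some (_, k) \<Rightarrow> enat k)"

definition worst_case_time :: "'a pdq_impl \<Rightarrow> real \<Rightarrow> nat \<Rightarrow> enat" where
  "worst_case_time P p n =
     (SUP (lt, A) \<in> {(lt, A). strict_weak_ordering lt \<and> length A = n}. running_time P p lt A)"

end

theory Submission
  imports Defs
begin

text \<open>
  Counting one extra slot per call, a call on \<open>m\<close> elements has weight \<open>M = m + 1\<close>, and the weights of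
  the two parts of a partition add up to \<open>M\<close>. The potential \<open>C * M * (t + \<beta> * log 2 M + 1)\<close> with
  \<open>\<beta> = -1 / log 2 (1 - p)\<close> drops by at least \<open>C * M\<close> in every partition step: a bad partition
  decreases the counter \<open>t\<close>, and a good one shrinks both weights by the factor \<open>1 - p\<close>, hence the
  logarithms by \<open>1 / \<beta>\<close>. This pays for the linear cost of the step. At \<open>t = 0\<close> the logarithmic term
  pays for heapsort. Sortedness of the intermediate arrays plays no role, only their length.
\<close>

section \<open>Cost of insertion sort, with and without a move budget\<close>

lemma length_swap [simp]: "length (swap i j A) = length A"
  by (simp add: swap_def)

lemma length_apply_swaps [simp]: "length (apply_swaps a sw A) = length A"
  unfolding apply_swaps_def by (induction sw arbitrary: A) auto

lemma insert_at_cost: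
  "insert_at lt a d l A = (ok, l', B, k) \<Longrightarrow> length B = length A \<and> k \<le> 4 * d + 1"
  by (induction lt a d l A arbitrary: ok l' B k rule: insert_at.induct)
    (fastforce split: if_splits prod.splits)+

text \<open>Every unit of budget spent pays for one comparison and one swap, 4 operations; the 1 is
  the final comparison, which moves nothing. Keeping the remaining budget on the left lets
  consecutive insertions share one budget.\<close>

lemma insert_at_cost_budget:
  "insert_at lt a d (enat l) A = (ok, l', B, k) \<Longrightarrow> \<exists>l''. l' = enat l'' \<and> k + 4 * l'' \<le> 4 * l + 1"
proof (induction d arbitrary: l A ok l' B k)
  case (Suc d)
  show ?case
  proof (cases "lt (A ! (a + Suc d)) (A ! (a + d)) \<and> l \<noteq> 0")
    case True
    then obtain n where n: "l = Suc n"
      by (cases l) auto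
    have e: "enat l - 1 = enat n"
      by (simp add: n one_enat_def)
    obtain ok1 l1 B1 k1 where rec:
      "insert_at lt a d (enat n) (swap (a + d) (a + Suc d) A) = (ok1, l1, B1, k1)"
      by (metis prod_cases4)
    have "l' = l1" "k = k1 + 4"
      using Suc.prems True rec e by (auto simp: enat_0_iff)
    with Suc.IH[OF rec] n show ?thesis
      by auto
  qed (use Suc.prems in \<open>auto simp: enat_0_iff split: if_splits\<close>)
qed auto

lemma insertion_loop_cost:
  "insertion_loop lt a ds l A = (ok, B, k) \<Longrightarrow>
    length B = length A \<and> k \<le> (\<Sum>d\<leftarrow>ds. 4 * d + 2)"
proof (induction ds arbitrary: l A ok B k)
  case (Cons d ds)
  obtain ok1 l1 B1 k1 where ins: "insert_at lt a d l A = (ok1, l1, B1, k1)"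
    by (metis prod_cases4)
  obtain ok2 B2 k2 where loop: "insertion_loop lt a ds l1 B1 = (ok2, B2, k2)"
    by (metis prod_cases3)
  show ?case
    using Cons.prems insert_at_cost[OF ins] Cons.IH[OF loop] ins loop by (auto split: if_splits)
qed auto

text \<open>The spent budget telescopes over the insertions. Beyond it, each insertion costs at most
  a final comparison and a loop iteration, hence the 2. This makes an aborting sort linear.\<close>

lemma insertion_loop_cost_budget:
  "insertion_loop lt a ds (enat l) A = (ok, B, k) \<Longrightarrow> k \<le> 4 * l + 2 * length ds"
proof (induction ds arbitrary: l A ok B k)
  case (Cons d ds)
  obtain ok1 l1' B1 k1 where ins': "insert_at lt a d (enat l) A = (ok1, l1', B1, k1)"
    by (metis prod_cases4)
  then obtain l1 where ins: "insert_at lt a d (enat l) A = (ok1, enat l1, B1, k1)"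
    and le: "k1 + 4 * l1 \<le> 4 * l + 1"
    using insert_at_cost_budget[OF ins'] by auto
  obtain ok2 B2 k2 where loop: "insertion_loop lt a ds (enat l1) B1 = (ok2, B2, k2)"
    by (metis prod_cases3)
  show ?case
    using Cons.prems le Cons.IH[OF loop] ins loop by (auto split: if_splits)
qed auto

lemma partial_insertion_sort_cost:
  assumes "partial_insertion_sort lt (enat l) a b A = (ok, B, k)"
  shows "length B = length A \<and> k \<le> 4 * l + 2 * (b - a)"
  using insertion_loop_cost[OF assms[unfolded partial_insertion_sort_def]]
    insertion_loop_cost_budget[OF assms[unfolded partial_insertion_sort_def]] by auto

text \<open>A quadratic bound suffices: it is constant on subarrays no longer than the
  threshold.\<close>

lemma insertion_sort_cost:
  assumes "insertion_sort lt a b A = (B, k)"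
  shows "length B = length A \<and> k \<le> (b - a) * (4 * (b - a) + 2)"
proof -
  obtain ok where "insertion_loop lt a [1..<b - a] \<infinity> A = (ok, B, k)"
    using assms unfolding insertion_sort_def partial_insertion_sort_def by (metis prod.collapse)
  note cost = insertion_loop_cost[OF this]
  have "(\<Sum>d\<leftarrow>[1..<b - a]. 4 * d + 2) \<le> (\<Sum>d\<leftarrow>[1..<b - a]. 4 * (b - a) + 2)"
    by (rule sum_list_mono) auto
  also have "\<dots> = (b - a - 1) * (4 * (b - a) + 2)"
    by (simp add: sum_list_triv)
  also have "\<dots> \<le> (b - a) * (4 * (b - a) + 2)"
    by (rule mult_le_mono1) simp
  finally show ?thesis
    using cost by linarith
qed

section \<open>Cost of sifting and of heapsort\<close>

text \<open>A descent costs 6 operations (call, two comparisons, swap) and goes to a child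
  \<open>j\<close> with \<open>j + 1 \<ge> 2 * (i + 1)\<close>, so the difference of logarithms
  drops by at least 1. The 3 covers the last call, where \<open>i \<le> m\<close> keeps the
  difference nonnegative.\<close>

lemma sift_down_cost:
  "sift_down lt a m i A = (B, k) \<Longrightarrow> i \<le> m \<Longrightarrow>
    length B = length A \<and> real k \<le> 3 + 6 * (log 2 (real m + 1) - log 2 (real i + 1))"
proof (induction lt a m i A arbitrary: B k rule: sift_down.induct)
  case (1 lt a m i A)
  define j where "j = (if 2 * i + 2 < m \<and> lt (A ! (a + (2 * i + 1))) (A ! (a + (2 * i + 2)))
                    then 2 * i + 2 else 2 * i + 1)"
  have unfold: "sift_down lt a m i A =
      (if m \<le> 2 * i + 1 then (A, 1)
       else if lt (A ! (a + i)) (A ! (a + j))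
       then let (B, k) = sift_down lt a m j (swap (a + i) (a + j) A) in (B, k + 6)
       else (A, 3))"
    by (subst sift_down.simps) (simp only: Let_def j_def)
  have log_le: "log 2 (real i + 1) \<le> log 2 (real m + 1)"
    using "1.prems" by simp
  show ?case
  proof (cases "\<not> m \<le> 2 * i + 1 \<and> lt (A ! (a + i)) (A ! (a + j))")
    case True
    obtain B1 k1 where rec: "sift_down lt a m j (swap (a + i) (a + j) A) = (B1, k1)"
      by fastforce
    have eq: "B = B1" "k = k1 + 6"
      using "1.prems"(1) True rec by (auto simp: unfold simp del: sift_down.simps)
    have "j \<le> m"
      using True by (auto simp: j_def)
    with "1.IH"[OF _ j_def _ rec] True
    have IH: "length B1 = length (swap (a + i) (a + j) A)"
      "real k1 \<le> 3 + 6 * (log 2 (real m + 1) - log 2 (real j + 1))"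
      by auto
    have "log 2 (real i + 1) + 1 = log 2 ((real i + 1) * 2)"
      by (subst log_mult) auto
    also have "\<dots> \<le> log 2 (real j + 1)"
      by (auto simp: j_def)
    finally show ?thesis
      using IH eq by simp
  next
    case False
    then have "B = A" "k \<le> 3"
      using "1.prems"(1)
      by (auto simp: unfold simp del: sift_down.simps split: if_splits)
    moreover from \<open>k \<le> 3\<close> have "real k \<le> 3"
      by simp
    ultimately show ?thesis
      using log_le by argo
  qed
qed

lemma build_heap_cost:
  "build_heap lt a m i A = (B, k) \<Longrightarrow> i \<le> m \<Longrightarrow>
    length B = length A \<and> real k \<le> real i * (4 + 6 * log 2 (real m + 1))"
proof (induction i arbitrary: A B k)
  case (Suc i)
  obtain B1 k1 where sift: "sift_down lt a m i A = (B1, k1)"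
    by fastforce
  obtain B2 k2 where rec: "build_heap lt a m i B1 = (B2, k2)"
    by fastforce
  have eq: "B = B2" "k = k1 + 1 + k2"
    using Suc.prems sift rec by auto
  have "0 \<le> log 2 (real i + 1)"
    by simp
  then have "real k1 \<le> 3 + 6 * log 2 (real m + 1)"
    using sift_down_cost[OF sift Suc_leD[OF Suc.prems(2)]] by argo
  then show ?case
    using sift_down_cost[OF sift] Suc.IH[OF rec] Suc.prems(2) eq by (auto simp: algebra_simps)
qed auto

text \<open>\<open>m\<close> stays fixed while the heap size \<open>e\<close> shrinks, so all
  extractions get the same logarithmic bound. The 7 is the 3 of the sift plus a swap and an
  iteration.\<close>

lemma extract_all_cost:
  "extract_all lt a e A = (B, k) \<Longrightarrow> e \<le> m \<Longrightarrow>
    length B = length A \<and> real k \<le> real e * (7 + 6 * log 2 (real m + 1))"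
proof (induction e arbitrary: A B k)
  case (Suc e)
  obtain B1 k1 where sift: "sift_down lt a e 0 (swap a (a + e) A) = (B1, k1)"
    by fastforce
  obtain B2 k2 where rec: "extract_all lt a e B1 = (B2, k2)"
    by fastforce
  have eq: "B = B2" "k = k1 + 4 + k2"
    using Suc.prems sift rec by auto
  have "log 2 (real e + 1) \<le> log 2 (real m + 1)"
    using Suc.prems by simp
  then have "real k1 \<le> 3 + 6 * log 2 (real m + 1)"
    using sift_down_cost[OF sift le0, THEN conjunct2, simplified] by argo
  then show ?case
    using sift_down_cost[OF sift] Suc.IH[OF rec] Suc.prems(2) eq by (auto simp: algebra_simps)
qed auto

lemma heapsort_cost:
  assumes "heapsort lt a b A = (B, k)"
  shows "length B = length A \<and> real k \<le> real (b - a) * (11 + 12 * log 2 (real (b - a) + 1))"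
proof -
  let ?m = "b - a"
  obtain B1 k1 where build: "build_heap lt a ?m (?m div 2) A = (B1, k1)"
    by fastforce
  obtain B2 k2 where ext: "extract_all lt a ?m B1 = (B2, k2)"
    by fastforce
  have eq: "B = B2" "k = k1 + k2"
    using assms build ext by (auto simp: heapsort_def)
  \<comment> \<open>Raising the \<open>?m div 2\<close> sifts of heap construction to
    \<open>?m\<close> lets the two phases add up to the constants 4 + 7 and 6 + 6.\<close>
  have "real (?m div 2) * (4 + 6 * log 2 (real ?m + 1)) \<le> real ?m * (4 + 6 * log 2 (real ?m + 1))"
    by (rule mult_right_mono) (auto intro!: add_nonneg_nonneg)
  then show ?thesis
    using build_heap_cost[OF build] extract_all_cost[OF ext order_refl] eq
    by (auto simp: algebra_simps)
qed

section \<open>Linear cost of one partition step\<close>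

text \<open>One \<open>K\<close> serves all orderings, arrays and subarrays, because the constants
  in the rules of \<open>valid_pdq_impl\<close> are uniform too. The final disjunction is what the
  recursion uses about the quality of a partition: the counter becomes \<open>t - 1\<close>, or each
  side keeps at least the fraction \<open>p\<close> of the elements.\<close>

lemma pdq_step_cost:
  fixes P :: "'a pdq_impl"
  assumes "valid_pdq_impl P"
  obtains K where
    "\<And>lt a b t A B r t' left fin k. \<lbrakk>strict_weak_ordering lt; threshold P < b - a; b \<le> length A;
       pdq_step P p lt a b t A = (B, r, t', left, fin, k)\<rbrakk> \<Longrightarrow>
       length B = length A \<and> a \<le> r \<and> r < b \<and> k \<le> K * (b - a) \<and>
       (t' = t - 1 \<or> t' = t \<and> p * real (b - a) \<le> real (min (r - a) (b - r - 1)))"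
proof -
  obtain K1 where K1: "\<And>lt a b A f k. \<lbrakk>strict_weak_ordering lt; threshold P < b - a; b \<le> length A;
      select_pivot P lt a b A = (f, k)\<rbrakk> \<Longrightarrow> k \<le> K1"
    using assms unfolding valid_pdq_impl_def pivot_rule_def by meson
  obtain K2 where K2: "\<And>lt a b A f r k. \<lbrakk>strict_weak_ordering lt; threshold P < b - a; b \<le> length A;
      partition_left P lt a b A = (f, r, k)\<rbrakk> \<Longrightarrow> r \<in> {a..<b} \<and> k \<le> K2 * (b - a)"
    using assms unfolding valid_pdq_impl_def partition_rule_def by meson
  obtain K3 where K3: "\<And>lt a b A f r k. \<lbrakk>strict_weak_ordering lt; threshold P < b - a; b \<le> length A;
      partition_right P lt a b A = (f, r, k)\<rbrakk> \<Longrightarrow> r \<in> {a..<b} \<and> k \<le> K3 * (b - a)"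
    using assms unfolding valid_pdq_impl_def partition_rule_def by meson
  obtain K4 where K4: "\<And>m. length (left_swaps P m) \<le> K4"
    using assms unfolding valid_pdq_impl_def swap_rule_def by meson
  obtain K5 where K5: "\<And>m. length (right_swaps P m) \<le> K5"
    using assms unfolding valid_pdq_impl_def swap_rule_def by meson
  \<comment> \<open>\<open>D\<close> collects the costs independent of the length: pivot selection,
    the 2 comparisons with the predecessor, 3 per swap, and \<open>4 * move_limit P\<close> for each
    of two partial insertion sorts. \<open>K\<close> adds the linear costs of either partition and
    of the partial sorts.\<close>
  define D where "D = K1 + 2 + 3 * K4 + 3 * K5 + 8 * move_limit P"
  define K where "K = D + K2 + K3 + 2"
  show ?thesis
  proof (rule that[of K])
    fix lt :: "'a \<Rightarrow> 'a \<Rightarrow> bool" and a b t A B r t' left fin k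
    assume swo: "strict_weak_ordering lt" and m: "threshold P < b - a" and b: "b \<le> length A"
      and step: "pdq_step P p lt a b t A = (B, r, t', left, fin, k)"
    obtain f k1 where sel: "select_pivot P lt a b A = (f, k1)"
      by fastforce
    define A1 where "A1 = permute_list f A"
    define lf where "lf = (a > 0 \<and> compares_equal lt (A1 ! (a - 1)) (A1 ! a))"
    obtain g s k3 where part:
      "(if lf then partition_left P lt a b A1 else partition_right P lt a b A1) = (g, s, k3)"
      by (metis prod_cases3)
    define A2 where "A2 = permute_list g A1"
    \<comment> \<open>Both partial sorts are named unconditionally, before the case distinction;
      only one branch of the step runs them.\<close>
    obtain ok1 A3 k4 where ins1:
      "partial_insertion_sort lt (enat (move_limit P)) a s A2 = (ok1, A3, k4)"
      by (metis prod_cases3)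
    obtain ok2 A4 k5 where ins2:
      "partial_insertion_sort lt (enat (move_limit P)) (s + 1) b A3 = (ok2, A4, k5)"
      by (metis prod_cases3)
    have len: "length A1 = length A" "length A2 = length A"
      by (simp_all add: A1_def A2_def)
    have k1: "k1 \<le> K1"
      using K1[OF swo m b sel] .
    have "s \<in> {a..<b} \<and> k3 \<le> (K2 + K3) * (b - a)"
      using K2[OF swo m, of A1 g s k3] K3[OF swo m, of A1 g s k3] part b len
      by (fastforce simp: distrib_right split: if_splits)
    then have s: "a \<le> s" "s < b" and k3: "k3 \<le> (K2 + K3) * (b - a)"
      by auto
    have ins1': "length A3 = length A2 \<and> k4 \<le> 4 * move_limit P + 2 * (s - a)"
      using partial_insertion_sort_cost[OF ins1] .
    have ins2': "length A4 = length A3 \<and> k5 \<le> 4 * move_limit P + 2 * (b - (s + 1))"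
      using partial_insertion_sort_cost[OF ins2] .
    have k45: "k4 + k5 \<le> 8 * move_limit P + 2 * (b - a)"
      using ins1' ins2' s by auto
    have len': "length A3 = length A" "length A4 = length A"
      using ins1' ins2' len by auto
    note swaps = K4[of "s - a"] K5[of "b - s - 1"]
    have total: "k \<le> D + (K2 + K3) * (b - a) + 2 * (b - a)" and
      rest: "length B = length A" "r = s"
      "t' = t - 1 \<or> t' = t \<and> p * real (b - a) \<le> real (min (s - a) (b - s - 1))"
      using step k1 k3 k45 swaps len len'
      unfolding pdq_step_def sel Let_def prod.case A1_def[symmetric] lf_def[symmetric] part
        A2_def[symmetric] ins1 ins2 D_def
      by (auto split: if_splits)
    \<comment> \<open>The subarray is nonempty, so the constant part is absorbed into the linear
      one.\<close>
    have "D * 1 \<le> D * (b - a)"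
      using m by (intro mult_le_mono2) auto
    then have "k \<le> K * (b - a)"
      using total by (simp add: K_def algebra_simps)
    with rest s show "length B = length A \<and> a \<le> r \<and> r < b \<and> k \<le> K * (b - a) \<and>
       (t' = t - 1 \<or> t' = t \<and> p * real (b - a) \<le> real (min (r - a) (b - r - 1)))"
      by simp
  qed
qed

section \<open>Potential bound for the whole recursion\<close>

text \<open>Termination and cost are proved together, since the induction on \<open>b - a\<close>
  also shows that the result is not \<open>None\<close>. The weight \<open>real (b - a) + 1\<close>
  keeps the logarithm nonnegative on empty parts.\<close>

lemma pdq_cost:
  fixes P :: "'a pdq_impl"
  assumes valid: "valid_pdq_impl P" and p: "0 < p" "p < 1"
  obtains C \<beta> :: real where "0 \<le> C" "0 \<le> \<beta>"
    "\<And>lt a b t A. strict_weak_ordering lt \<Longrightarrow> b \<le> length A \<Longrightarrow>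
      \<exists>B k. pdq P p lt a b t A = Some (B, k) \<and> length B = length A \<and>
        real k \<le> C * (real (b - a) + 1) * (real t + \<beta> * log 2 (real (b - a) + 1) + 1)"
proof -
  obtain K where K:
    "\<And>lt a b t A B r t' left fin k. \<lbrakk>strict_weak_ordering lt; threshold P < b - a; b \<le> length A;
       pdq_step P p lt a b t A = (B, r, t', left, fin, k)\<rbrakk> \<Longrightarrow>
       length B = length A \<and> a \<le> r \<and> r < b \<and> k \<le> K * (b - a) \<and>
       (t' = t - 1 \<or> t' = t \<and> p * real (b - a) \<le> real (min (r - a) (b - r - 1)))"
    using pdq_step_cost[OF valid] by blast
  define \<delta> where "\<delta> = - log 2 (1 - p)"
  define \<beta> where "\<beta> = 1 / \<delta>"
  define c where "c = threshold P"
  \<comment> \<open>The summands pay for partition steps, for insertion sort below the threshold,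
    and for the linear and the logarithmic part of heapsort; \<open>12 * \<delta>\<close> is chosen
    to give \<open>12 \<le> C * \<beta>\<close>.\<close>
  define C where "C = real K + real (c * (4 * c + 2)) + 12 + 12 * \<delta>"
  define F where "F M t = C * M * (real t + \<beta> * log 2 M + 1)" for M t
  have \<delta>: "0 < \<delta>"
    using p by (simp add: \<delta>_def)
  then have \<beta>: "0 < \<beta>" "\<beta> * \<delta> = 1"
    by (simp_all add: \<beta>_def)
  have C: "12 \<le> C" "real K + 1 \<le> C" "real (c * (4 * c + 2)) + 1 \<le> C" "12 \<le> C * \<beta>"
  proof -
    have "12 * \<delta> * \<beta> \<le> C * \<beta>"
      using \<beta>(1) \<delta> by (intro mult_right_mono) (auto simp: C_def)
    then show "12 \<le> C * \<beta>"
      using \<beta>(2) by (simp add: algebra_simps)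
  qed (use \<delta> in \<open>auto simp: C_def\<close>)
  have F_ge: "C * M \<le> F M t" if "1 \<le> M" for M t
  proof -
    have "C * M * 1 \<le> C * M * (real t + \<beta> * log 2 M + 1)"
      using that C \<beta> by (intro mult_left_mono) auto
    then show ?thesis
      by (simp add: F_def)
  qed
  \<comment> \<open>The bracket of each part is at most \<open>X\<close>, the bracket of the whole
    without its summand 1. Weighted by \<open>M1\<close> and \<open>M2\<close>, the two savings add
    up to \<open>C * (M1 + M2)\<close>.\<close>
  have F_split: "C * (M1 + M2) + F M1 t' + F M2 t' \<le> F (M1 + M2) t"
    if M: "1 \<le> M1" "1 \<le> M2" and t: "0 < t"
      and cases: "t' = t - 1 \<or> t' = t \<and> M1 \<le> (1 - p) * (M1 + M2) \<and> M2 \<le> (1 - p) * (M1 + M2)"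
    for M1 M2 :: real and t t' :: nat
  proof -
    define X where "X = real t + \<beta> * log 2 (M1 + M2)"
    \<comment> \<open>If \<open>t' = t - 1\<close>, the counter supplies the saved 1, which requires
      \<open>0 < t\<close> because subtraction is truncated. Otherwise the logarithm drops by
      \<delta>, and \<open>\<beta> * \<delta> = 1\<close>.\<close>
    have bound: "real t' + \<beta> * log 2 N + 1 \<le> X" if N: "1 \<le> N" "N \<le> M1 + M2"
      "t' = t \<Longrightarrow> N \<le> (1 - p) * (M1 + M2)" for N
    proof (cases "t' = t - 1")
      case True
      have "\<beta> * log 2 N \<le> \<beta> * log 2 (M1 + M2)"
        using N \<beta> by (intro mult_left_mono) auto
      then show ?thesis
        using True t by (auto simp: X_def of_nat_diff)
    next
      case False
      then have "t' = t"
        using cases by auto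
      then have "log 2 N \<le> log 2 ((1 - p) * (M1 + M2))"
        using N p M by (intro log_mono) auto
      also have "\<dots> = log 2 (M1 + M2) - \<delta>"
        using p M by (subst log_mult) (auto simp: \<delta>_def)
      finally have "\<beta> * log 2 N \<le> \<beta> * (log 2 (M1 + M2) - \<delta>)"
        using \<beta> by (intro mult_left_mono) auto
      then show ?thesis
        using \<beta>(2) \<open>t' = t\<close> by (simp add: X_def algebra_simps)
    qed
    have "F N t' \<le> C * N * X" if "1 \<le> N" "N \<le> M1 + M2" "t' = t \<Longrightarrow> N \<le> (1 - p) * (M1 + M2)" for N
      unfolding F_def using bound[OF that] that C by (intro mult_left_mono) auto
    from this[of M1] this[of M2] have "F M1 t' + F M2 t' \<le> C * M1 * X + C * M2 * X"
      using M cases t by fastforce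
    also have "C * M1 * X + C * M2 * X + C * (M1 + M2) = F (M1 + M2) t"
      by (simp add: F_def X_def algebra_simps)
    finally show ?thesis
      by simp
  qed
  \<comment> \<open>Length preservation belongs to the induction claim: the second recursive call
    runs on the output of the first and needs \<open>b\<close> within its length.\<close>
  have main: "\<exists>B k. pdq P p lt a b t A = Some (B, k) \<and> length B = length A \<and>
        real k \<le> F (real (b - a) + 1) t"
    if swo: "strict_weak_ordering lt" and "b \<le> length A"
    for lt :: "'a \<Rightarrow> 'a \<Rightarrow> bool" and a b t A
    using that(2)
  proof (induction "b - a" arbitrary: a b t A rule: less_induct)
    case less
    note unfold = pdq.simps[of P p lt a b t A]
    let ?M = "real (b - a) + 1"
    consider (small) "b - a \<le> threshold P" | (heap) "threshold P < b - a" "t = 0" |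
      (part) "threshold P < b - a" "0 < t"
      by linarith
    then show ?case
    proof cases
      case small
      obtain B k where ins: "insertion_sort lt a b A = (B, k)"
        by fastforce
      have "(b - a) * (4 * (b - a) + 2) \<le> c * (4 * c + 2)"
        using small unfolding c_def by (intro mult_le_mono) auto
      then have "k + 1 \<le> c * (4 * c + 2) + 1"
        using insertion_sort_cost[OF ins] by linarith
      then have "real (k + 1) \<le> C"
        using C(3) by linarith
      also have "C \<le> C * ?M"
        using C by (simp add: algebra_simps)
      also have "\<dots> \<le> F ?M t"
        by (rule F_ge) simp
      finally show ?thesis
        using small ins insertion_sort_cost[OF ins] by (simp add: unfold)
    next
      case heap
      obtain B k where hs: "heapsort lt a b A = (B, k)"
        by fastforce
      let ?m = "real (b - a)"
      have "real k + 1 \<le> ?m * (11 + 12 * log 2 ?M) + 1"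
        using heapsort_cost[OF hs] by simp
      also have "\<dots> \<le> ?M * (12 * log 2 ?M + 12)"
      proof -
        have "0 \<le> log 2 ?M"
          by simp
        then show ?thesis
          by (simp add: algebra_simps)
      qed
      also have "\<dots> \<le> ?M * (C * \<beta> * log 2 ?M + C)"
        using C by (intro mult_left_mono add_mono mult_right_mono) auto
      also have "\<dots> = F ?M t"
        using heap by (simp add: F_def algebra_simps)
      finally have "real (k + 1) \<le> F ?M t"
        by simp
      moreover have "pdq P p lt a b t A = Some (B, k + 1)"
        using heap hs unfolding unfold by simp
      ultimately show ?thesis
        using heapsort_cost[OF hs] by blast
    next
      case part
      obtain B r t' left fin k where step: "pdq_step P p lt a b t A = (B, r, t', left, fin, k)"
        by (metis prod_cases6)
      let ?M1 = "real (r - a) + 1" and ?M2 = "real (b - (r + 1)) + 1"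
      have len: "length B = length A" and r: "a \<le> r" "r < b" and k: "k \<le> K * (b - a)"
        and t': "t' = t - 1 \<or> t' = t \<and> p * real (b - a) \<le> real (min (r - a) (b - r - 1))"
        using K[OF swo part(1) less.prems step] by auto
      \<comment> \<open>The parts hold one element fewer than the whole; the pivot supplies the
        second extra slot.\<close>
      have M: "?M = ?M1 + ?M2"
        using r by (simp add: of_nat_diff)
      have "real k \<le> real K * real (b - a)"
        using k by (metis of_nat_le_iff of_nat_mult)
      also have "\<dots> + 1 \<le> (real K + 1) * ?M"
        by (simp add: algebra_simps)
      also have "\<dots> \<le> C * ?M"
        using C by (intro mult_right_mono) auto
      finally have kC: "real k + 1 \<le> C * ?M"
        by simp
      have "t' = t - 1 \<or> t' = t \<and> ?M1 \<le> (1 - p) * (?M1 + ?M2) \<and> ?M2 \<le> (1 - p) * (?M1 + ?M2)"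
      proof -
        \<comment> \<open>Each weight is at least \<open>p * (b - a) + 1\<close>, hence at least
          \<open>p * ?M\<close> as \<open>p < 1\<close>; subtracting it from \<open>?M\<close>
          bounds the other weight.\<close>
        have "?M1 \<le> (1 - p) * ?M \<and> ?M2 \<le> (1 - p) * ?M"
          if "p * real (b - a) \<le> real (min (r - a) (b - r - 1))"
        proof -
          have "p * real (b - a) \<le> real (r - a)" "p * real (b - a) \<le> real (b - (r + 1))"
            using that by auto
          then show ?thesis
            using M p by (simp add: algebra_simps)
        qed
        then show ?thesis
          using t' M by metis
      qed
      then have split: "C * ?M + F ?M1 t' + F ?M2 t' \<le> F ?M t"
        unfolding M using part(2) by (intro F_split) auto
      \<comment> \<open>Needed when a part is not recursed on: its potential may then be dropped
        from the sum.\<close>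
      have pos: "0 \<le> F ?M1 t'" "0 \<le> F ?M2 t'"
        using F_ge[of ?M1 t'] F_ge[of ?M2 t'] C by (smt (verit) mult_nonneg_nonneg of_nat_0_le_iff)+
      \<comment> \<open>Stated for any \<open>D\<close> of the right length, since the right call
        receives either \<open>B\<close> or the output of the left call.\<close>
      have right: "\<exists>E k. pdq P p lt (r + 1) b t' D = Some (E, k) \<and> length E = length D \<and>
        real k \<le> F ?M2 t'" if "length D = length A" for D
        using less.hyps[of b "r + 1" D t'] that less.prems r by simp
      have leftp: "\<exists>D k. pdq P p lt a r t' B = Some (D, k) \<and> length D = length B \<and>
        real k \<le> F ?M1 t'"
        using less.hyps[of r a B t'] len less.prems r by simp
      consider (fin) fin | (left) "\<not> fin" left | (both) "\<not> fin" "\<not> left"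
        by blast
      then show ?thesis
      proof cases
        case fin
        then show ?thesis
          using part step len kC pos split by (simp add: unfold)
      next
        case left
        obtain E k' where "pdq P p lt (r + 1) b t' B = Some (E, k')" "length E = length B"
          "real k' \<le> F ?M2 t'"
          using right[OF len] by blast
        then show ?thesis
          using left part step len kC pos split by (simp add: unfold)
      next
        case both
        obtain D k' where D: "pdq P p lt a r t' B = Some (D, k')" "length D = length B"
          "real k' \<le> F ?M1 t'"
          using leftp by blast
        obtain E k'' where "pdq P p lt (r + 1) b t' D = Some (E, k'')" "length E = length D"
          "real k'' \<le> F ?M2 t'"
          using right[of D] D len by auto
        then show ?thesis
          using D both part step len kC split by (simp add: unfold)
      qed
    qed
  qed
  show ?thesis
    using that[of C \<beta>] C(1) \<beta>(1) main unfolding F_def by simp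
qed

section \<open>Asymptotic bound for the worst case\<close>

theorem theorem2:
  fixes P :: "'a pdq_impl" and p :: real
  assumes "valid_pdq_impl P" and "0 < p" and "p < 1"
  shows "(\<forall>n\<ge>1. worst_case_time P p n \<noteq> \<infinity>) \<and>
         (\<lambda>n. real (the_enat (worst_case_time P p n))) \<in> O(\<lambda>n. real n * log 2 (real n))"
proof -
  obtain C \<beta> :: real where C: "0 \<le> C" and \<beta>: "0 \<le> \<beta>" and cost:
    "\<And>lt a b t A. strict_weak_ordering lt \<Longrightarrow> b \<le> length A \<Longrightarrow>
      \<exists>B k. pdq P p lt a b t A = Some (B, k) \<and> length B = length A \<and>
        real k \<le> C * (real (b - a) + 1) * (real t + \<beta> * log 2 (real (b - a) + 1) + 1)"
    using pdq_cost[OF assms] by blast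
  define T where "T n = C * (real n + 1) *
    (real (nat \<lfloor>log 2 (real n)\<rfloor>) + \<beta> * log 2 (real n + 1) + 1)" for n
  have T_nonneg: "0 \<le> T n" for n
    using C \<beta> by (auto simp: T_def intro!: mult_nonneg_nonneg add_nonneg_nonneg)
  \<comment> \<open>Costs are natural numbers, so the real bound may be rounded down; a bound of the
    form \<open>enat\<close> also makes the supremum finite.\<close>
  have worst: "worst_case_time P p n \<le> enat (nat \<lfloor>T n\<rfloor>)" for n
    unfolding worst_case_time_def
  proof (rule SUP_least, clarify)
    fix lt :: "'a \<Rightarrow> 'a \<Rightarrow> bool" and A :: "'a list"
    assume swo: "strict_weak_ordering lt" and n: "n = length A"
    obtain B k where "pdqsort P p lt A = Some (B, k)" "real k \<le> T n"
      using cost[OF swo order_refl, where A = A and a = 0 and t = "nat \<lfloor>log 2 (real (length A))\<rfloor>"]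
      by (auto simp: pdqsort_def T_def n)
    then show "running_time P p lt A \<le> enat (nat \<lfloor>T (length A)\<rfloor>)"
      by (simp add: running_time_def n le_nat_floor)
  qed
  have "real (the_enat (worst_case_time P p n)) \<le> T n" for n
  proof -
    obtain w where w: "worst_case_time P p n = enat w" "w \<le> nat \<lfloor>T n\<rfloor>"
      using worst[of n] by (metis enat_ile enat_ord_simps(1))
    then have "real w \<le> real (nat \<lfloor>T n\<rfloor>)"
      by simp
    also have "\<dots> \<le> T n"
      using T_nonneg by (rule of_nat_floor)
    finally show ?thesis
      using w by simp
  qed
  \<comment> \<open>From 2 on, \<open>1 \<le> log 2 (real n)\<close> and
    \<open>n + 1 \<le> n * n\<close>, so the bracket is at most
    \<open>2 * (1 + \<beta>) * log 2 (real n)\<close>; the prefactor is at most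
    \<open>2 * C * n\<close>. At 1 the bound would be 0.\<close>
  moreover have "T n \<le> 4 * C * (1 + \<beta>) * (real n * log 2 (real n))" if "2 \<le> n" for n
  proof -
    have log: "1 \<le> log 2 (real n)"
      using that by simp
    have "log 2 (real n + 1) \<le> log 2 (real n * real n)"
    proof -
      have "real n + 1 \<le> real n * 2"
        using that by simp
      also have "\<dots> \<le> real n * real n"
        using that by (intro mult_left_mono) auto
      finally show ?thesis
        by (intro log_mono) auto
    qed
    also have "\<dots> = 2 * log 2 (real n)"
      using that by (subst log_mult) auto
    finally have "\<beta> * log 2 (real n + 1) \<le> \<beta> * (2 * log 2 (real n))"
      using \<beta> by (rule mult_left_mono)
    moreover have "real (nat \<lfloor>log 2 (real n)\<rfloor>) \<le> log 2 (real n)"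
      using log by (intro of_nat_floor) simp
    ultimately have "real (nat \<lfloor>log 2 (real n)\<rfloor>) + \<beta> * log 2 (real n + 1) + 1
        \<le> log 2 (real n) + \<beta> * (2 * log 2 (real n)) + log 2 (real n)"
      using log by linarith
    also have "\<dots> = 2 * (1 + \<beta>) * log 2 (real n)"
      by (simp add: algebra_simps)
    finally have "real (nat \<lfloor>log 2 (real n)\<rfloor>) + \<beta> * log 2 (real n + 1) + 1
        \<le> 2 * (1 + \<beta>) * log 2 (real n)" .
    moreover have "C * (real n + 1) \<le> C * (2 * real n)"
      using C that by (intro mult_left_mono) auto
    ultimately have "T n \<le> C * (2 * real n) * (2 * (1 + \<beta>) * log 2 (real n))"
      unfolding T_def using C \<beta> that by (intro mult_mono) (auto intro!: add_nonneg_nonneg)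
    then show ?thesis
      by (simp add: algebra_simps)
  qed
  ultimately have "eventually (\<lambda>n. norm (real (the_enat (worst_case_time P p n)))
      \<le> 4 * C * (1 + \<beta>) * norm (real n * log 2 (real n))) at_top"
    by (intro eventually_mono[OF eventually_ge_at_top[of 2]])
      (smt (verit) norm_ge_zero real_norm_def of_nat_0_le_iff mult_nonneg_nonneg C \<beta>
        mult_left_mono abs_ge_self)
  then have "(\<lambda>n. real (the_enat (worst_case_time P p n))) \<in> O(\<lambda>n. real n * log 2 (real n))"
    by (rule bigoI)
  moreover have "worst_case_time P p n \<noteq> \<infinity>" for n
    using worst[of n] by (metis enat_ile enat.distinct(1))
  ultimately show ?thesis
    by blast
qed

end
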